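(* Let $\mathsf{Stat}_1,\ldots,\mathsf{Stat}_r$ be set-valued statistics on partial permutations, let $\mathbf{Z}^{\mathbf{Stat}(\pi)}:=\mathbf{z}_1^{\mathsf{Stat}_1(\pi)}\cdots\mathbf{z}_r^{\mathsf{Stat}_r(\pi)}$, and suppose that the entries $a_{n,k}$ of the extended Catalan matrix $A^{\mathbf{s},\mathbf{t}}$ with extended seeds $\mathbf{s}=(s^{(i)}_\ell)$ and $\mathbf{t}=(t^{(i)}_\ell)$ satisfy $$a_{n,k}=\sum_{\pi\in\mathfrak{P}_{n,k}}\mathbf{Z}^{\mathbf{Stat}(\pi)}\qquad(n,k\ge0).$$ Suppose further that the following hold for all $n\ge1$, $k\ge0$: 1. for any $\rho\in\mathfrak{P}_{n-1,k-1}$, $\displaystyle\sum_{\pi\in\mathfrak{P}^{(1)}_{n,k},\,\pi'=\rho}\mathbf{Z}^{\mathbf{Stat}(\pi)}=\mathbf{Z}^{\mathbf{Stat}(\rho)}$; 2. for any $\rho\in\mathfrak{P}_{n-1,k}$, $\displaystyle\sum_{\pi\in\mathfrak{P}^{(2)}_{n,k}\cup\mathfrak{P}^{(3)}_{n,k},\,\pi'=\rho}\mathbf{Z}^{\mathbf{Stat}(\pi)}=s^{(n)}_k\mathbf{Z}^{\mathbf{Stat}(\rho)}$; 3. for any $\rho\in\mathfrak{P}_{n-1,k+1}$, $\displaystyle\sum_{\pi\in\mathfrak{P}^{(4)}_{n,k},\,\pi'=\rho}\mathbf{Z}^{\mathbf{Stat}(\pi)}=t^{(n)}_{k+1}\mathbf{Z}^{\mathbf{Stat}(\rho)}$.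 Let $\mathbf{s}^+=(s^{(i+1)}_{\ell+1})_{\ell\ge0,i\ge1}$ and $\mathbf{t}^+=(t^{(i+1)}_{\ell+1})_{\ell\ge1,i\ge1}$, and let $A^{\mathbf{s}^+,\mathbf{t}^+}$ be the extended Catalan matrix generated by them. Then for all $n,k\ge0$ $$\left[A^{\mathbf{s}^+,\mathbf{t}^+}\right]_{n,k}=C_{n+1,k+1}(\mathbf{Z}),$$ and for all $n\ge2$ $$C_{n,0}(\mathbf{Z})=t^{(n)}_1C_{n-1,1}(\mathbf{Z}).$$
   Context: Extended Catalan matrix: given extended seeds $\mathbf{s}=(s^{(i)}_\ell)_{\ell\ge0,i\ge1}$ and $\mathbf{t}=(t^{(i)}_\ell)_{\ell\ge1,i\ge1}$, $A^{\mathbf{s},\mathbf{t}}=(a_{n,k})_{n,k\ge0}$ is defined by $a_{0,0}=1$, $a_{0,k}=0$ for $k>0$, and $a_{n,k}=a_{n-1,k-1}+s^{(n)}_ka_{n-1,k}+t^{(n)}_{k+1}a_{n-1,k+1}$ for $n\ge1$, with $a_{n,-1}=0$. Seeds take values in a commutative ring containing the variables. A partial permutation of order $n$ is an $n\times n$ $(0,1)$-matrix $\pi=(\pi_{i,j})$ with at most one $1$ in each row and each column; $\mathfrak{P}_{n,k}$ is the set of those with exactly $k$ zero rows (for $n=0$ there is only the empty matrix, lying in $\mathfrak{P}_{0,0}$; $\mathfrak{P}_{n,-1}=\emptyset$). For $n\ge1$, $\mathfrak{P}_{n,k}$ is the disjoint union of: $\mathfrak{P}^{(1)}_{n,k}$,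 those $\pi$ whose last row and last column are both zero; $\mathfrak{P}^{(2)}_{n,k}$, those with $\pi_{n,n}=1$; $\mathfrak{P}^{(3)}_{n,k}$, those with $\pi_{n,n}=0$ and exactly one of the last row and the last column zero; $\mathfrak{P}^{(4)}_{n,k}$, those with $\pi_{n,n}=0$ and neither the last row nor the last column zero. For $\pi$ of order $n\ge1$, $\pi'$ is the partial permutation of order $n-1$ obtained by deleting the last row and column. A set-valued statistic assigns to each partial permutation (of any order) a finite set of positive integers. For a set $S$ and a sequence of variables $\mathbf{z}_j=(z_{j,1},z_{j,2},\ldots)$, $\mathbf{z}_j^{S}=\prod_{i\in S}z_{j,i}$. A partial permutation $\pi\in\mathfrak{P}_{n,k}$ is connected if there is no $1\le i<n$ such that the principal submatrix formed by the first $i$ rows and columns is a permutation matrix. $\mathfrak{C}_{n,k}$ is the set of connected elements of $\mathfrak{P}_{n,k}$, and $C_{n,k}(\mathbf{Z})=\sum_{\pi\in\mathfrak{C}_{n,k}}\mathbf{Z}^{\mathbf{Stat}(\pi)}$. *)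

theory Defs
  imports "Jordan_Normal_Form.Matrix" "Jordan_Normal_Form.DL_Submatrix"
begin

(* Seeds are written s i l for s^(i)_l.  Only s i l with i >= 1 and t i l with i, l >= 1 are
   ever used.  The case distinction on k implements a_{n,-1} = 0. *)
fun ext_catalan ::
  "(nat \<Rightarrow> nat \<Rightarrow> 'a::comm_ring_1) \<Rightarrow> (nat \<Rightarrow> nat \<Rightarrow> 'a) \<Rightarrow> nat \<Rightarrow> nat \<Rightarrow> 'a" where
  "ext_catalan s t 0 k = (if k = 0 then 1 else 0)"
| "ext_catalan s t (Suc n) k =
     (if k = 0 then 0 else ext_catalan s t n (k - 1))
     + s (Suc n) k * ext_catalan s t n k
     + t (Suc n) (k + 1) * ext_catalan s t n (k + 1)"

definition shift_seed :: "(nat \<Rightarrow> nat \<Rightarrow> 'a) \<Rightarrow> nat \<Rightarrow> nat \<Rightarrow> 'a" where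
  "shift_seed s = (\<lambda>i l. s (i + 1) (l + 1))"

(* Matrix indices start at 0: the last row and column of a matrix of order n have index n - 1. *)
definition partial_permutations :: "nat \<Rightarrow> nat mat set" where
  "partial_permutations n = {\<pi> \<in> carrier_mat n n.
     (\<forall>i<n. \<forall>j<n. \<pi> $$ (i, j) \<in> {0, 1}) \<and>
     (\<forall>i<n. card {j. j < n \<and> \<pi> $$ (i, j) = 1} \<le> 1) \<and>
     (\<forall>j<n. card {i. i < n \<and> \<pi> $$ (i, j) = 1} \<le> 1)}"

definition permutation_matrix :: "nat \<Rightarrow> nat mat \<Rightarrow> bool" where
  "permutation_matrix n \<pi> \<longleftrightarrow> \<pi> \<in> carrier_mat n n \<and>
     (\<forall>i<n. \<forall>j<n. \<pi> $$ (i, j) \<in> {0, 1}) \<and>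
     (\<forall>i<n. card {j. j < n \<and> \<pi> $$ (i, j) = 1} = 1) \<and>
     (\<forall>j<n. card {i. i < n \<and> \<pi> $$ (i, j) = 1} = 1)"

abbreviation zero_row :: "nat mat \<Rightarrow> nat \<Rightarrow> bool" where
  "zero_row \<pi> i \<equiv> row \<pi> i = 0\<^sub>v (dim_col \<pi>)"

abbreviation zero_col :: "nat mat \<Rightarrow> nat \<Rightarrow> bool" where
  "zero_col \<pi> j \<equiv> col \<pi> j = 0\<^sub>v (dim_row \<pi>)"

definition PP :: "nat \<Rightarrow> nat \<Rightarrow> nat mat set" where
  "PP n k = {\<pi> \<in> partial_permutations n. card {i. i < n \<and> zero_row \<pi> i} = k}"

(* The four classes are meant for n >= 1 only. *)
definition PP1 :: "nat \<Rightarrow> nat \<Rightarrow> nat mat set" where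
  "PP1 n k = {\<pi> \<in> PP n k. zero_row \<pi> (n - 1) \<and> zero_col \<pi> (n - 1)}"

definition PP2 :: "nat \<Rightarrow> nat \<Rightarrow> nat mat set" where
  "PP2 n k = {\<pi> \<in> PP n k. \<pi> $$ (n - 1, n - 1) = 1}"

definition PP3 :: "nat \<Rightarrow> nat \<Rightarrow> nat mat set" where
  "PP3 n k = {\<pi> \<in> PP n k. \<pi> $$ (n - 1, n - 1) = 0 \<and>
     zero_row \<pi> (n - 1) \<noteq> zero_col \<pi> (n - 1)}"

definition PP4 :: "nat \<Rightarrow> nat \<Rightarrow> nat mat set" where
  "PP4 n k = {\<pi> \<in> PP n k. \<pi> $$ (n - 1, n - 1) = 0 \<and>
     \<not> zero_row \<pi> (n - 1) \<and> \<not> zero_col \<pi> (n - 1)}"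

definition leading :: "nat \<Rightarrow> 'b mat \<Rightarrow> 'b mat" where
  "leading i \<pi> = submatrix \<pi> {..<i} {..<i}"

definition delete_last :: "'b mat \<Rightarrow> 'b mat" where
  "delete_last \<pi> = submatrix \<pi> {..<dim_row \<pi> - 1} {..<dim_col \<pi> - 1}"

definition connected_pp :: "nat \<Rightarrow> nat mat \<Rightarrow> bool" where
  "connected_pp n \<pi> \<longleftrightarrow> \<not> (\<exists>i. 1 \<le> i \<and> i < n \<and> permutation_matrix i (leading i \<pi>))"

definition CP :: "nat \<Rightarrow> nat \<Rightarrow> nat mat set" where
  "CP n k = {\<pi> \<in> PP n k. connected_pp n \<pi>}"

(* The order of a partial permutation is recoverable from its dimensions, so a statistic is a
   function of the matrix alone; its values on other matrices are irrelevant. *)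
definition set_valued_statistic :: "(nat mat \<Rightarrow> nat set) \<Rightarrow> bool" where
  "set_valued_statistic S \<longleftrightarrow>
     (\<forall>n. \<forall>\<pi> \<in> partial_permutations n. finite (S \<pi>) \<and> (\<forall>i \<in> S \<pi>. 1 \<le> i))"

(* z j i stands for z_{j,i}. *)
definition weight ::
  "nat \<Rightarrow> (nat \<Rightarrow> nat \<Rightarrow> 'a::comm_ring_1) \<Rightarrow> (nat \<Rightarrow> nat mat \<Rightarrow> nat set) \<Rightarrow> nat mat \<Rightarrow> 'a" where
  "weight r z Stat \<pi> = (\<Prod>j=1..r. \<Prod>i\<in>Stat j \<pi>. z j i)"

definition C_poly ::
  "nat \<Rightarrow> (nat \<Rightarrow> nat \<Rightarrow> 'a::comm_ring_1) \<Rightarrow> (nat \<Rightarrow> nat mat \<Rightarrow> nat set) \<Rightarrow> nat \<Rightarrow> nat \<Rightarrow> 'a" where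
  "C_poly r z Stat n k = (\<Sum>\<pi>\<in>CP n k. weight r z Stat \<pi>)"

end

theory Submission
  imports Defs
begin

text \<open>
  For order at least 2, a partial permutation is connected iff deleting its last row and column
  leaves a connected one with at least one zero row: the leading blocks to be tested are those of
  \<open>\<pi>'\<close> together with \<open>\<pi>'\<close> itself, which is a permutation matrix iff it has no
  zero rows.  So the fibres of \<open>\<pi> \<mapsto> \<pi>'\<close> over connected \<open>\<rho>\<close> with a zero row consist
  of connected elements only, all other fibres contain none, and the three hypotheses turn into the
  Catalan recurrence for the numbers \<open>C\<^bsub>n,k\<^esub>\<close> with the column \<open>k = 0\<close> cut off.
\<close>

section \<open>Leading blocks and the entrywise form of partial permutations\<close>

text \<open>\<open>submatrix\<close> reads entries through \<open>pick\<close>, which enumerates an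
  index set in increasing order. On an initial segment \<open>pick\<close> is the identity, so a
  leading block keeps its indices.\<close>

lemma leading_eq:
  assumes "i \<le> dim_row \<pi>" "i \<le> dim_col \<pi>"
  shows "leading i \<pi> = mat i i (\<lambda>(a, b). \<pi> $$ (a, b))"
proof -
  have pick: "pick {..<i} a = a" if "a < i" for a
  proof -
    have "{x \<in> {..<i}. x < a} = {..<a}" using that by auto
    then show ?thesis using pick_card_in_set[of a "{..<i}"] that by simp
  qed
  have "{a. a < dim_row \<pi> \<and> a \<in> {..<i}} = {..<i}" "{a. a < dim_col \<pi> \<and> a \<in> {..<i}} = {..<i}"
    using assms by auto
  then show ?thesis
    unfolding leading_def submatrix_def by (intro eq_matI) (auto simp: pick)
qed

lemma delete_last_eq_leading: "\<pi> \<in> carrier_mat (Suc m) (Suc m) \<Longrightarrow> delete_last \<pi> = leading m \<pi>"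
  by (auto simp: delete_last_def leading_def)

lemma leading_leading:
  assumes "\<pi> \<in> carrier_mat n n" "i \<le> m" "m \<le> n"
  shows "leading i (leading m \<pi>) = leading i \<pi>"
  using assms by (subst (1 2 3) leading_eq) (auto simp: leading_eq)

text \<open>Trades the cardinality bounds for uniqueness of the position of a 1, the form used when
  entries are compared.\<close>

lemma partial_permutations_iff:
  "\<pi> \<in> partial_permutations n \<longleftrightarrow> \<pi> \<in> carrier_mat n n \<and>
     (\<forall>i<n. \<forall>j<n. \<pi> $$ (i, j) = 0 \<or> \<pi> $$ (i, j) = 1) \<and>
     (\<forall>i<n. \<forall>j<n. \<forall>j'<n. \<pi> $$ (i, j) = 1 \<longrightarrow> \<pi> $$ (i, j') = 1 \<longrightarrow> j = j') \<and>
     (\<forall>j<n. \<forall>i<n. \<forall>i'<n. \<pi> $$ (i, j) = 1 \<longrightarrow> \<pi> $$ (i', j) = 1 \<longrightarrow> i = i')"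
proof -
  have "card {j. j < n \<and> P j} \<le> 1 \<longleftrightarrow> (\<forall>j<n. \<forall>j'<n. P j \<longrightarrow> P j' \<longrightarrow> j = j')" for P :: "nat \<Rightarrow> bool"
    by (auto simp: card_le_Suc0_iff_eq)
  then show ?thesis by (simp add: partial_permutations_def)
qed

lemma partial_permutationsD:
  assumes "\<pi> \<in> partial_permutations n"
  shows "\<pi> \<in> carrier_mat n n"
    and "\<And>i j. i < n \<Longrightarrow> j < n \<Longrightarrow> \<pi> $$ (i, j) = 0 \<or> \<pi> $$ (i, j) = 1"
    and "\<And>i j j'. i < n \<Longrightarrow> j < n \<Longrightarrow> j' < n \<Longrightarrow> \<pi> $$ (i, j) = 1 \<Longrightarrow> \<pi> $$ (i, j') = 1 \<Longrightarrow> j = j'"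
    and "\<And>i i' j. i < n \<Longrightarrow> i' < n \<Longrightarrow> j < n \<Longrightarrow> \<pi> $$ (i, j) = 1 \<Longrightarrow> \<pi> $$ (i', j) = 1 \<Longrightarrow> i = i'"
proof -
  have row: "\<forall>i<n. \<forall>j<n. \<forall>j'<n. \<pi> $$ (i, j) = 1 \<longrightarrow> \<pi> $$ (i, j') = 1 \<longrightarrow> j = j'"
    and col: "\<forall>j<n. \<forall>i<n. \<forall>i'<n. \<pi> $$ (i, j) = 1 \<longrightarrow> \<pi> $$ (i', j) = 1 \<longrightarrow> i = i'"
    using assms unfolding partial_permutations_iff by - (elim conjE, assumption)+
  show "\<pi> \<in> carrier_mat n n"
    and "\<And>i j. i < n \<Longrightarrow> j < n \<Longrightarrow> \<pi> $$ (i, j) = 0 \<or> \<pi> $$ (i, j) = 1"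
    using assms by (simp_all add: partial_permutations_iff)
  show "j = j'" if "i < n" "j < n" "j' < n" "\<pi> $$ (i, j) = 1" "\<pi> $$ (i, j') = 1" for i j j'
    using row[rule_format, OF that] .
  show "i = i'" if "i < n" "i' < n" "j < n" "\<pi> $$ (i, j) = 1" "\<pi> $$ (i', j) = 1" for i i' j
    using col[rule_format, OF that(3,1,2,4,5)] .
qed

lemma leading_in_partial_permutations:
  assumes "\<pi> \<in> partial_permutations n" "m \<le> n"
  shows "leading m \<pi> \<in> partial_permutations m"
proof -
  have eq: "leading m \<pi> = mat m m (\<lambda>(a, b). \<pi> $$ (a, b))"
    using assms by (intro leading_eq) (auto simp: partial_permutations_iff)
  have lt: "i < n" if "i < m" for i using that assms(2) by simp
  show ?thesis
    unfolding eq partial_permutations_iff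
  proof (intro conjI allI impI)
    fix i j j' assume "i < m" "j < m" "j' < m"
      "mat m m (\<lambda>(a, b). \<pi> $$ (a, b)) $$ (i, j) = 1" "mat m m (\<lambda>(a, b). \<pi> $$ (a, b)) $$ (i, j') = 1"
    then have "\<pi> $$ (i, j) = 1" "\<pi> $$ (i, j') = 1" by auto
    then show "j = j'"
      using partial_permutationsD(3)[OF assms(1)] lt \<open>i < m\<close> \<open>j < m\<close> \<open>j' < m\<close> by blast
  next
    fix j i i' assume "j < m" "i < m" "i' < m"
      "mat m m (\<lambda>(a, b). \<pi> $$ (a, b)) $$ (i, j) = 1" "mat m m (\<lambda>(a, b). \<pi> $$ (a, b)) $$ (i', j) = 1"
    then have "\<pi> $$ (i, j) = 1" "\<pi> $$ (i', j) = 1" by auto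
    then show "i = i'"
      using partial_permutationsD(4)[OF assms(1)] lt \<open>j < m\<close> \<open>i < m\<close> \<open>i' < m\<close> by blast
  next
    fix i j assume "i < m" "j < m"
    then show "mat m m (\<lambda>(a, b). \<pi> $$ (a, b)) $$ (i, j) = 0 \<or> mat m m (\<lambda>(a, b). \<pi> $$ (a, b)) $$ (i, j) = 1"
      using partial_permutationsD(2)[OF assms(1)] lt by simp
  qed simp
qed

section \<open>Zero rows under deletion of the last row and column\<close>

lemma zero_row_iff: "\<pi> \<in> carrier_mat n n \<Longrightarrow> i < n \<Longrightarrow> zero_row \<pi> i \<longleftrightarrow> (\<forall>j<n. \<pi> $$ (i, j) = 0)"
  by (auto simp: vec_eq_iff)

lemma zero_col_iff: "\<pi> \<in> carrier_mat n n \<Longrightarrow> j < n \<Longrightarrow> zero_col \<pi> j \<longleftrightarrow> (\<forall>i<n. \<pi> $$ (i, j) = 0)"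
  by (auto simp: vec_eq_iff)

text \<open>A row above the last becomes zero in the leading block iff it was zero already or its 1
  sits in the last column. Since that column holds at most one 1, at most one zero row is gained; a
  zero last row is lost.\<close>

lemma card_zero_rows_leading:
  assumes "\<pi> \<in> partial_permutations (Suc m)"
  shows "card {i. i < m \<and> zero_row (leading m \<pi>) i} + (if zero_row \<pi> m then 1 else 0) =
    card {i. i < Suc m \<and> zero_row \<pi> i} + (if \<exists>i<m. \<pi> $$ (i, m) = 1 then 1 else 0)"
proof -
  have car: "\<pi> \<in> carrier_mat (Suc m) (Suc m)"
    and ent: "\<And>i j. i \<le> m \<Longrightarrow> j \<le> m \<Longrightarrow> \<pi> $$ (i, j) = 0 \<or> \<pi> $$ (i, j) = 1"
    and row1: "\<And>i j j'. i \<le> m \<Longrightarrow> j \<le> m \<Longrightarrow> j' \<le> m \<Longrightarrow> \<pi> $$ (i, j) = 1 \<Longrightarrow> \<pi> $$ (i, j') = 1 \<Longrightarrow> j = j'"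
    and col1: "\<And>i i' j. i \<le> m \<Longrightarrow> i' \<le> m \<Longrightarrow> j \<le> m \<Longrightarrow> \<pi> $$ (i, j) = 1 \<Longrightarrow> \<pi> $$ (i', j) = 1 \<Longrightarrow> i = i'"
    using partial_permutationsD[OF assms] by (auto simp only: less_Suc_eq_le)
  let ?Z = "{i. i < m \<and> zero_row \<pi> i}" and ?L = "{i. i < m \<and> \<pi> $$ (i, m) = 1}"
  have lead: "leading m \<pi> \<in> carrier_mat m m"
    using leading_in_partial_permutations[OF assms, of m] by (simp add: partial_permutations_iff)
  have idx: "leading m \<pi> $$ (i, j) = \<pi> $$ (i, j)" if "i < m" "j < m" for i j
    using car that by (subst leading_eq) auto
  have zl: "zero_row (leading m \<pi>) i \<longleftrightarrow> (\<forall>j<m. \<pi> $$ (i, j) = 0)" if "i < m" for i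
    using zero_row_iff[OF lead that] idx that by auto
  have zp: "zero_row \<pi> i \<longleftrightarrow> (\<forall>j<m. \<pi> $$ (i, j) = 0) \<and> \<pi> $$ (i, m) = 0" if "i < m" for i
    using zero_row_iff[OF car, of i] that by (auto simp: less_Suc_eq)
  have off: "\<pi> $$ (i, j) = 0" if "i < m" "\<pi> $$ (i, m) = 1" "j < m" for i j
    using row1[of i j m] ent[of i j] that by auto
  have "zero_row (leading m \<pi>) i \<longleftrightarrow> zero_row \<pi> i \<or> \<pi> $$ (i, m) = 1" if "i < m" for i
    unfolding zl[OF that] zp[OF that] using off[OF that] ent[of i m] that
    by (metis order.strict_implies_order order_refl)
  then have "{i. i < m \<and> zero_row (leading m \<pi>) i} = ?Z \<union> ?L"
    by auto
  moreover have "?Z \<inter> ?L = {}" using zp by auto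
  ultimately have 1: "card {i. i < m \<and> zero_row (leading m \<pi>) i} = card ?Z + card ?L"
    by (simp add: card_Un_disjoint)
  have "{i. i < Suc m \<and> zero_row \<pi> i} = ?Z \<union> (if zero_row \<pi> m then {m} else {})"
    by (auto simp: less_Suc_eq)
  then have 2: "card {i. i < Suc m \<and> zero_row \<pi> i} = card ?Z + (if zero_row \<pi> m then 1 else 0)"
    by simp
  \<comment> \<open>Uniqueness of the 1 within the last column turns this cardinality into an
    indicator.\<close>
  have 3: "card ?L = (if \<exists>i<m. \<pi> $$ (i, m) = 1 then 1 else 0)"
  proof (cases "\<exists>i<m. \<pi> $$ (i, m) = 1")
    case True
    then obtain i where "i < m" "\<pi> $$ (i, m) = 1" by blast
    then have "?L = {i}" using col1[of _ i m] by auto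
    then show ?thesis using True by simp
  next
    case False
    then have "?L = {}" by blast
    then show ?thesis using False by auto
  qed
  show ?thesis using 1 2 3 by simp
qed

text \<open>The balance of zero rows in terms of two indicators. Each of the four classes determines
  their difference, and thereby the number of zero rows of \<pi>'.\<close>

lemma PP_Suc:
  assumes "\<pi> \<in> PP (Suc m) k"
  shows "delete_last \<pi> \<in> PP m (card {i. i < m \<and> zero_row (delete_last \<pi>) i})"
    and "card {i. i < m \<and> zero_row (delete_last \<pi>) i} + (if zero_row \<pi> m then 1 else 0) =
      k + (if \<exists>i<m. \<pi> $$ (i, m) = 1 then 1 else 0)"
proof -
  have pp: "\<pi> \<in> partial_permutations (Suc m)" and k: "card {i. i < Suc m \<and> zero_row \<pi> i} = k"
    using assms by (auto simp: PP_def)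
  have eq: "delete_last \<pi> = leading m \<pi>"
    using pp by (simp add: delete_last_eq_leading partial_permutations_iff)
  show "delete_last \<pi> \<in> PP m (card {i. i < m \<and> zero_row (delete_last \<pi>) i})"
    unfolding PP_def using leading_in_partial_permutations[OF pp, of m] by (simp add: eq)
  show "card {i. i < m \<and> zero_row (delete_last \<pi>) i} + (if zero_row \<pi> m then 1 else 0) =
      k + (if \<exists>i<m. \<pi> $$ (i, m) = 1 then 1 else 0)"
    unfolding eq using card_zero_rows_leading[OF pp] k by simp
qed

lemma PP_Suc_last:
  assumes "\<pi> \<in> PP (Suc m) k"
  shows "zero_row \<pi> m \<longleftrightarrow> (\<forall>j<m. \<pi> $$ (m, j) = 0) \<and> \<pi> $$ (m, m) = 0"
    and "zero_col \<pi> m \<longleftrightarrow> (\<forall>i<m. \<pi> $$ (i, m) = 0) \<and> \<pi> $$ (m, m) = 0"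
    and "\<pi> $$ (m, m) = 0 \<or> \<pi> $$ (m, m) = 1"
    and "i < m \<Longrightarrow> \<pi> $$ (i, m) = 0 \<or> \<pi> $$ (i, m) = 1"
    and "i < m \<Longrightarrow> \<pi> $$ (m, m) = 1 \<Longrightarrow> \<pi> $$ (i, m) = 0"
proof -
  have pp: "\<pi> \<in> partial_permutations (Suc m)" using assms by (simp add: PP_def)
  then have car: "\<pi> \<in> carrier_mat (Suc m) (Suc m)" by (simp add: partial_permutations_iff)
  show "zero_row \<pi> m \<longleftrightarrow> (\<forall>j<m. \<pi> $$ (m, j) = 0) \<and> \<pi> $$ (m, m) = 0"
    using zero_row_iff[OF car, of m] by (auto simp: less_Suc_eq)
  show "zero_col \<pi> m \<longleftrightarrow> (\<forall>i<m. \<pi> $$ (i, m) = 0) \<and> \<pi> $$ (m, m) = 0"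
    using zero_col_iff[OF car, of m] by (auto simp: less_Suc_eq)
  show "\<pi> $$ (m, m) = 0 \<or> \<pi> $$ (m, m) = 1" "i < m \<Longrightarrow> \<pi> $$ (i, m) = 0 \<or> \<pi> $$ (i, m) = 1"
    using partial_permutationsD(2)[OF pp] by simp_all
  have "\<pi> $$ (i, m) = 1 \<Longrightarrow> \<pi> $$ (m, m) = 1 \<Longrightarrow> i < m \<Longrightarrow> i = m"
    using partial_permutationsD(4)[OF pp, of i m m] by simp
  then show "i < m \<Longrightarrow> \<pi> $$ (m, m) = 1 \<Longrightarrow> \<pi> $$ (i, m) = 0"
    using \<open>i < m \<Longrightarrow> \<pi> $$ (i, m) = 0 \<or> \<pi> $$ (i, m) = 1\<close> by auto
qed

section \<open>The four classes under deletion\<close>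

text \<open>The zero last row disappears and the zero last column creates no new zero row, so
  exactly one zero row is lost.\<close>

lemma PP1_delete_last:
  assumes "\<pi> \<in> PP1 (Suc m) k"
  shows "k \<ge> 1" "delete_last \<pi> \<in> PP m (k - 1)"
proof -
  have pp: "\<pi> \<in> PP (Suc m) k" and z: "zero_row \<pi> m" "zero_col \<pi> m"
    using assms by (auto simp: PP1_def)
  have "\<not> (\<exists>i<m. \<pi> $$ (i, m) = 1)" using z PP_Suc_last(2)[OF pp] by auto
  then have "card {i. i < m \<and> zero_row (delete_last \<pi>) i} + 1 = k"
    using PP_Suc(2)[OF pp] z by simp
  then show "k \<ge> 1" "delete_last \<pi> \<in> PP m (k - 1)" using PP_Suc(1)[OF pp] by auto
qed

lemma PP2_delete_last:
  assumes "\<pi> \<in> PP2 (Suc m) k"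
  shows "delete_last \<pi> \<in> PP m k"
proof -
  have pp: "\<pi> \<in> PP (Suc m) k" and one: "\<pi> $$ (m, m) = 1" using assms by (auto simp: PP2_def)
  have "\<not> zero_row \<pi> m" "\<not> (\<exists>i<m. \<pi> $$ (i, m) = 1)"
    using one PP_Suc_last[OF pp] by auto
  then have "card {i. i < m \<and> zero_row (delete_last \<pi>) i} = k" using PP_Suc(2)[OF pp] by simp
  then show ?thesis using PP_Suc(1)[OF pp] by simp
qed

text \<open>With a zero corner and exactly one of the last row and column zero, the last row is zero
  iff the last column has a 1 above the corner. The two indicators agree and cancel.\<close>

lemma PP3_delete_last:
  assumes "\<pi> \<in> PP3 (Suc m) k"
  shows "delete_last \<pi> \<in> PP m k"
proof -
  have pp: "\<pi> \<in> PP (Suc m) k" and c: "\<pi> $$ (m, m) = 0" "zero_row \<pi> m \<longleftrightarrow> \<not> zero_col \<pi> m"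
    using assms by (auto simp: PP3_def)
  have "zero_row \<pi> m \<longleftrightarrow> (\<exists>i<m. \<pi> $$ (i, m) = 1)"
    unfolding c(2) using c(1) PP_Suc_last(2,4)[OF pp] by (metis zero_neq_one)
  then have "card {i. i < m \<and> zero_row (delete_last \<pi>) i} = k"
    using PP_Suc(2)[OF pp] by (simp split: if_splits)
  then show ?thesis using PP_Suc(1)[OF pp] by simp
qed

text \<open>The 1 in the last column lies above the corner, so its row becomes zero, while the last
  row was not zero: one zero row is gained.\<close>

lemma PP4_delete_last:
  assumes "\<pi> \<in> PP4 (Suc m) k"
  shows "delete_last \<pi> \<in> PP m (k + 1)"
proof -
  have pp: "\<pi> \<in> PP (Suc m) k" and c: "\<pi> $$ (m, m) = 0" "\<not> zero_row \<pi> m" "\<not> zero_col \<pi> m"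
    using assms by (auto simp: PP4_def)
  have "\<exists>i<m. \<pi> $$ (i, m) = 1"
    using c(1,3) PP_Suc_last(2,4)[OF pp] by (metis zero_neq_one)
  then have "card {i. i < m \<and> zero_row (delete_last \<pi>) i} = k + 1"
    using PP_Suc(2)[OF pp] c(2) by simp
  then show ?thesis using PP_Suc(1)[OF pp] by simp
qed

text \<open>\<open>PP2\<close> and \<open>PP3\<close> stay together because the second hypothesis
  sums over their union. A 1 in the corner excludes a zero last row, which separates
  \<open>PP1\<close> from \<open>PP2\<close>.\<close>

lemma PP_Suc_partition:
  "PP (Suc m) k = PP1 (Suc m) k \<union> (PP2 (Suc m) k \<union> PP3 (Suc m) k) \<union> PP4 (Suc m) k"
  "PP1 (Suc m) k \<inter> (PP2 (Suc m) k \<union> PP3 (Suc m) k) = {}"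
  "(PP1 (Suc m) k \<union> (PP2 (Suc m) k \<union> PP3 (Suc m) k)) \<inter> PP4 (Suc m) k = {}"
proof -
  have last: "\<pi> $$ (m, m) = 0 \<or> \<pi> $$ (m, m) = 1" "zero_row \<pi> m \<Longrightarrow> \<pi> $$ (m, m) = 0"
    if "\<pi> \<in> PP (Suc m) k" for \<pi>
    using PP_Suc_last(1,3)[OF that] by simp_all
  note defs = PP1_def PP2_def PP3_def PP4_def diff_Suc_1
  show "PP (Suc m) k = PP1 (Suc m) k \<union> (PP2 (Suc m) k \<union> PP3 (Suc m) k) \<union> PP4 (Suc m) k"
    unfolding defs using last(1) by blast
  show "PP1 (Suc m) k \<inter> (PP2 (Suc m) k \<union> PP3 (Suc m) k) = {}"
    unfolding defs using last(2) by force
  show "(PP1 (Suc m) k \<union> (PP2 (Suc m) k \<union> PP3 (Suc m) k)) \<inter> PP4 (Suc m) k = {}"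
    unfolding defs by force
qed

section \<open>Finiteness, permutation matrices and connectedness\<close>

text \<open>Each element is the \<open>mat\<close> image of a 0-1 function on the index square.
  Finiteness is what allows the weight sums to be split and grouped.\<close>

lemma finite_PP: "finite (PP n k)"
proof -
  let ?F = "({..<n} \<times> {..<n}) \<rightarrow>\<^sub>E {0, 1 :: nat}"
  have "\<pi> \<in> mat n n ` ?F" if "\<pi> \<in> partial_permutations n" for \<pi>
  proof
    let ?f = "restrict (\<lambda>ij. \<pi> $$ ij) ({..<n} \<times> {..<n})"
    show "\<pi> = mat n n ?f" using that by (intro eq_matI) (auto dest: partial_permutationsD(1))
    show "?f \<in> ?F" using partial_permutationsD(2)[OF that] by (intro restrict_PiE_iff[THEN iffD2]) auto
  qed
  then have "PP n k \<subseteq> mat n n ` ?F" by (auto simp: PP_def)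
  moreover have "finite (mat n n ` ?F)" by (intro finite_imageI finite_PiE) auto
  ultimately show ?thesis by (rule finite_subset)
qed

text \<open>Without zero rows there are \<open>n\<close> ones in total; as each of the
  \<open>n\<close> columns holds at most one, each holds exactly one.\<close>

lemma permutation_matrix_iff_PP:
  assumes "\<rho> \<in> PP n k"
  shows "permutation_matrix n \<rho> \<longleftrightarrow> k = 0"
proof -
  have pp: "\<rho> \<in> partial_permutations n" and k: "k = card {i. i < n \<and> zero_row \<rho> i}"
    using assms by (auto simp: PP_def)
  then have car: "\<rho> \<in> carrier_mat n n" by (simp add: partial_permutations_iff)
  let ?R = "\<lambda>i. {j. j < n \<and> \<rho> $$ (i, j) = 1}" and ?C = "\<lambda>j. {i. i < n \<and> \<rho> $$ (i, j) = 1}"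
  have row0: "zero_row \<rho> i \<longleftrightarrow> card (?R i) = 0" if "i < n" for i
  proof -
    have "\<rho> $$ (i, j) = 0 \<longleftrightarrow> \<rho> $$ (i, j) \<noteq> 1" if "j < n" for j
      using partial_permutationsD(2)[OF pp \<open>i < n\<close> that] by auto
    then show ?thesis using zero_row_iff[OF car that] by auto
  qed
  have k0: "k = 0 \<longleftrightarrow> (\<forall>i<n. \<not> zero_row \<rho> i)" unfolding k by auto
  have le: "card (?R i) \<le> 1" "card (?C i) \<le> 1" if "i < n" for i
    using pp that by (auto simp: partial_permutations_def)
  show ?thesis
  proof
    assume "permutation_matrix n \<rho>"
    then show "k = 0" unfolding k0 using row0 by (auto simp: permutation_matrix_def)
  next
    assume "k = 0"
    have one: "card (?R i) = 1" if "i < n" for i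
    proof -
      have "card (?R i) \<noteq> 0" using \<open>k = 0\<close> k0 row0[OF that] that by blast
      then show ?thesis using le(1)[OF that] by linarith
    qed
    \<comment> \<open>Double counting of the ones, by columns and by rows.\<close>
    have "(\<Sum>j<n. card (?C j)) = (\<Sum>i<n. card (?R i))"
      using sum.swap_restrict[of "{..<n}" "{..<n}" "\<lambda>_ _. 1 :: nat" "\<lambda>i j. \<rho> $$ (i, j) = 1"]
      by simp
    then have "(\<Sum>j<n. card (?C j)) = (\<Sum>j<n. 1)" using one by simp
    \<comment> \<open>Equal sums with termwise \<le> force termwise equality.\<close>
    then have "card (?C j) = 1" if "j < n" for j
      using sum_mono_inv[of "\<lambda>j. card (?C j)" "{..<n}" "\<lambda>_. 1" j] le(2) that by auto
    then show "permutation_matrix n \<rho>"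
      using pp one by (simp add: permutation_matrix_def partial_permutations_def)
  qed
qed

text \<open>Here \<open>k\<close> counts the zero rows of \<pi>', so \<open>k \<ge> 1\<close> says
  that \<pi>' is not a permutation matrix. The assumption \<open>m \<ge> 1\<close> puts the block of
  order \<open>m\<close> among those tested; for \<open>m = 0\<close> no block is tested at
  all.\<close>

lemma connected_pp_Suc:
  assumes "\<pi> \<in> PP (Suc m) K" "m \<ge> 1" "delete_last \<pi> \<in> PP m k"
  shows "connected_pp (Suc m) \<pi> \<longleftrightarrow> connected_pp m (delete_last \<pi>) \<and> k \<ge> 1"
proof -
  have car: "\<pi> \<in> carrier_mat (Suc m) (Suc m)"
    using assms(1) by (simp add: PP_def partial_permutations_iff)
  then have eq: "delete_last \<pi> = leading m \<pi>" by (rule delete_last_eq_leading)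
  have "permutation_matrix m (leading m \<pi>) \<longleftrightarrow> k = 0"
    using permutation_matrix_iff_PP[OF assms(3)] eq by simp
  moreover have "leading i (delete_last \<pi>) = leading i \<pi>" if "i \<le> m" for i
    unfolding eq using leading_leading[OF car that] by simp
  ultimately show ?thesis
    unfolding connected_pp_def less_Suc_eq using assms(2) by auto
qed

text \<open>One statement for all three hypotheses: \<open>K\<close> counts zero rows before
  deletion and \<open>k\<close> after it, and the applications have \<open>k\<close> equal to
  \<open>K - 1\<close>, \<open>K\<close> and \<open>K + 1\<close>, with \<open>c\<close> equal to 1,
  an entry of \<open>s\<close> and an entry of \<open>t\<close>.\<close>

lemma sum_connected_class:
  fixes w :: "nat mat \<Rightarrow> 'a::comm_ring_1"
  assumes "m \<ge> 1" and X: "X \<subseteq> PP (Suc m) K" and del: "\<And>\<pi>. \<pi> \<in> X \<Longrightarrow> delete_last \<pi> \<in> PP m k"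
    and fibre: "\<And>\<rho>. \<rho> \<in> PP m k \<Longrightarrow> (\<Sum>\<pi> \<in> {\<pi> \<in> X. delete_last \<pi> = \<rho>}. w \<pi>) = c * w \<rho>"
  shows "(\<Sum>\<pi> \<in> {\<pi> \<in> X. connected_pp (Suc m) \<pi>}. w \<pi>) =
    (if k = 0 then 0 else c * (\<Sum>\<rho>\<in>CP m k. w \<rho>))"
proof -
  let ?Y = "{\<pi> \<in> X. connected_pp (Suc m) \<pi>}"
  have conn: "connected_pp (Suc m) \<pi> \<longleftrightarrow> connected_pp m (delete_last \<pi>) \<and> k \<ge> 1" if "\<pi> \<in> X" for \<pi>
    using connected_pp_Suc[OF _ assms(1) del[OF that]] X that by auto
  show ?thesis
  proof (cases "k = 0")
    case True
    then have "?Y = {}" using conn by auto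
    then show ?thesis using True by (simp only: sum.empty simp_thms if_True)
  next
    case False
    have fin: "finite ?Y" "finite (CP m k)"
      using finite_subset[OF X finite_PP] finite_PP[of m k] by (auto simp: CP_def)
    have img: "delete_last ` ?Y \<subseteq> CP m k" using conn del by (auto simp: CP_def)
    have "(\<Sum>\<pi>\<in>?Y. w \<pi>) = (\<Sum>\<rho>\<in>CP m k. \<Sum>\<pi>\<in>{\<pi> \<in> ?Y. delete_last \<pi> = \<rho>}. w \<pi>)"
      by (rule sum.group[OF fin img, symmetric])
    also have "\<dots> = (\<Sum>\<rho>\<in>CP m k. c * w \<rho>)"
    proof (rule sum.cong[OF refl])
      fix \<rho> assume \<rho>: "\<rho> \<in> CP m k"
      \<comment> \<open>On \<open>X\<close>, connectedness depends only on \<pi>', so restricting to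
        connected elements removes nothing from a fibre over connected \<rho>, and
        \<open>fibre\<close> applies unchanged.\<close>
      have "{\<pi> \<in> ?Y. delete_last \<pi> = \<rho>} = {\<pi> \<in> X. delete_last \<pi> = \<rho>}"
        using conn \<rho> False by (auto simp: CP_def)
      then show "(\<Sum>\<pi>\<in>{\<pi> \<in> ?Y. delete_last \<pi> = \<rho>}. w \<pi>) = c * w \<rho>"
        using fibre[of \<rho>] \<rho> by (simp add: CP_def)
    qed
    finally show ?thesis using False by (simp add: sum_distrib_left)
  qed
qed

lemma PP_0: "PP 0 k = (if k = 0 then {mat 0 0 (\<lambda>_. 0)} else {})"
  by (auto simp: PP_def partial_permutations_iff)

section \<open>The recurrence for connected elements and the comparison of entries\<close>

theorem theorem6p2:
  fixes s t z :: "nat \<Rightarrow> nat \<Rightarrow> 'a::comm_ring_1"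
    and r :: nat
    and Stat :: "nat \<Rightarrow> nat mat \<Rightarrow> nat set"
  assumes stat: "\<And>j. 1 \<le> j \<Longrightarrow> j \<le> r \<Longrightarrow> set_valued_statistic (Stat j)"
    and entries: "\<And>n k. ext_catalan s t n k = (\<Sum>\<pi>\<in>PP n k. weight r z Stat \<pi>)"
    and cond1: "\<And>n k \<rho>. n \<ge> 1 \<Longrightarrow> k \<ge> 1 \<Longrightarrow> \<rho> \<in> PP (n - 1) (k - 1) \<Longrightarrow>
      (\<Sum>\<pi> \<in> {\<pi> \<in> PP1 n k. delete_last \<pi> = \<rho>}. weight r z Stat \<pi>) = weight r z Stat \<rho>"
    and cond2: "\<And>n k \<rho>. n \<ge> 1 \<Longrightarrow> \<rho> \<in> PP (n - 1) k \<Longrightarrow>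
      (\<Sum>\<pi> \<in> {\<pi> \<in> PP2 n k \<union> PP3 n k. delete_last \<pi> = \<rho>}. weight r z Stat \<pi>)
        = s n k * weight r z Stat \<rho>"
    and cond3: "\<And>n k \<rho>. n \<ge> 1 \<Longrightarrow> \<rho> \<in> PP (n - 1) (k + 1) \<Longrightarrow>
      (\<Sum>\<pi> \<in> {\<pi> \<in> PP4 n k. delete_last \<pi> = \<rho>}. weight r z Stat \<pi>)
        = t n (k + 1) * weight r z Stat \<rho>"
  shows "(\<forall>n k. ext_catalan (shift_seed s) (shift_seed t) n k = C_poly r z Stat (n + 1) (k + 1)) \<and>
         (\<forall>n\<ge>2. C_poly r z Stat n 0 = t n 1 * C_poly r z Stat (n - 1) 1)"
proof -
  let ?w = "weight r z Stat" and ?C = "C_poly r z Stat"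
  \<comment> \<open>The guard \<open>k \<le> 1\<close> merges two reasons: for \<open>k = 0\<close>
    the class \<open>PP1\<close> is empty, and for \<open>k = 1\<close> deletion leaves no zero row,
    so nothing is connected. The latter reason also gives the guard on the \<open>s\<close> term;
    the \<open>t\<close> term is never cut.\<close>
  have rec: "?C (Suc m) k = (if k \<le> 1 then 0 else ?C m (k - 1))
      + (if k = 0 then 0 else s (Suc m) k * ?C m k) + t (Suc m) (k + 1) * ?C m (k + 1)"
    if m: "m \<ge> 1" for m k
  proof -
    let ?conn = "\<lambda>X. {\<pi> \<in> X. connected_pp (Suc m) \<pi>}"
    let ?P1 = "PP1 (Suc m) k" and ?P23 = "PP2 (Suc m) k \<union> PP3 (Suc m) k" and ?P4 = "PP4 (Suc m) k"
    have sub: "?P1 \<subseteq> PP (Suc m) k" "?P23 \<subseteq> PP (Suc m) k" "?P4 \<subseteq> PP (Suc m) k"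
      using PP_Suc_partition(1) by auto
    have fin: "finite ?P1" "finite ?P23" "finite ?P4"
      by (rule finite_subset[OF _ finite_PP], rule sub)+
    have "CP (Suc m) k = ?conn ?P1 \<union> ?conn ?P23 \<union> ?conn ?P4"
      unfolding CP_def by (subst PP_Suc_partition(1)) auto
    moreover have "?conn ?P1 \<inter> ?conn ?P23 = {}" "(?conn ?P1 \<union> ?conn ?P23) \<inter> ?conn ?P4 = {}"
      using PP_Suc_partition(2,3)[of m k] by auto
    ultimately have "?C (Suc m) k = sum ?w (?conn ?P1) + sum ?w (?conn ?P23) + sum ?w (?conn ?P4)"
      using fin unfolding C_poly_def by (simp add: sum.union_disjoint)
    moreover have "sum ?w (?conn ?P1) = (if k \<le> 1 then 0 else ?C m (k - 1))"
    proof (cases "k = 0")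
      case True
      \<comment> \<open>Treated apart because \<open>k - 1\<close> is truncated to 0 here, whereas
        the recurrence means column -1.\<close>
      then have "?P1 = {}" using PP1_delete_last(1) by fastforce
      then show ?thesis using True by simp
    next
      case False
      have "sum ?w (?conn ?P1) = (if k - 1 = 0 then 0 else 1 * ?C m (k - 1))"
        unfolding C_poly_def
        using False cond1[of "Suc m" k]
        by (intro sum_connected_class[OF m sub(1)]) (auto dest: PP1_delete_last(2))
      then show ?thesis using False by auto
    qed
    moreover have "sum ?w (?conn ?P23) = (if k = 0 then 0 else s (Suc m) k * ?C m k)"
      unfolding C_poly_def using cond2[of "Suc m" _ k]
      by (intro sum_connected_class[OF m sub(2)]) (auto simp: PP2_delete_last PP3_delete_last)
    moreover have "sum ?w (?conn ?P4) = (if k + 1 = 0 then 0 else t (Suc m) (k + 1) * ?C m (k + 1))"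
      unfolding C_poly_def using cond3[of "Suc m" _ k]
      by (intro sum_connected_class[OF m sub(3)]) (auto dest: PP4_delete_last)
    ultimately show ?thesis by simp
  qed
  \<comment> \<open>Order 1 lies outside the range of \<open>rec\<close>; it has to match row 0 of
    the shifted Catalan matrix.\<close>
  have base: "?C 1 (k + 1) = (if k = 0 then 1 else 0)" for k
  proof -
    \<comment> \<open>In the three other classes, the deleted matrix would have order 0 and a
      positive number of zero rows, which is impossible.\<close>
    have all: "delete_last \<pi> \<in> PP 0 k \<and> \<pi> \<in> PP1 1 (k + 1)" if "\<pi> \<in> PP 1 (k + 1)" for \<pi>
    proof -
      from that consider "\<pi> \<in> PP1 (Suc 0) (k + 1)" | "\<pi> \<in> PP2 (Suc 0) (k + 1)"
        | "\<pi> \<in> PP3 (Suc 0) (k + 1)" | "\<pi> \<in> PP4 (Suc 0) (k + 1)"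
        using PP_Suc_partition(1)[of 0 "k + 1"] by auto
      then show ?thesis
        by cases (use PP1_delete_last PP2_delete_last PP3_delete_last PP4_delete_last in
          \<open>fastforce simp: PP_0 split: if_splits\<close>)+
    qed
    \<comment> \<open>No \<open>i\<close> satisfies \<open>1 \<le> i < 1\<close>, so connectedness
      is vacuous.\<close>
    have CP: "CP 1 (k + 1) = PP 1 (k + 1)" by (auto simp: CP_def connected_pp_def)
    show ?thesis
    proof (cases "k = 0")
      case False
      then have "PP 1 (k + 1) = {}" using all by (auto simp: PP_0)
      then show ?thesis using False by (simp add: C_poly_def CP[simplified])
    next
      case True
      let ?\<rho> = "mat 0 0 (\<lambda>_. 0) :: nat mat"
      have "PP 1 1 = {\<pi> \<in> PP1 1 1. delete_last \<pi> = ?\<rho>}"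
        using all True by (auto simp: PP_0 PP1_def)
      then have "?C 1 1 = ?w ?\<rho>"
        using cond1[of 1 1 ?\<rho>] CP True by (simp add: C_poly_def PP_0)
      \<comment> \<open>The weight of the empty matrix is not 1 by definition, since statistics are
        arbitrary there; it is the entry of the Catalan matrix at (0, 0).\<close>
      also have "\<dots> = 1" using entries[of 0 0] by (simp add: PP_0)
      finally show ?thesis using True by simp
    qed
  qed
  have "ext_catalan (shift_seed s) (shift_seed t) n k = ?C (n + 1) (k + 1)" for n k
  proof (induction n arbitrary: k)
    case 0
    then show ?case using base[of k] by simp
  next
    case (Suc n)
    \<comment> \<open>At column \<open>k + 1\<close> the guard \<open>k + 1 \<le> 1\<close> becomes
      \<open>k = 0\<close>, the boundary case of \<open>ext_catalan\<close>, and the coefficients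
      are the shifted seeds.\<close>
    then show ?case using rec[of "Suc n" "k + 1"] by (simp add: shift_seed_def)
  qed
  moreover have "?C n 0 = t n 1 * ?C (n - 1) 1" if "n \<ge> 2" for n
    \<comment> \<open>In column 0 both guarded terms vanish and only the \<open>t\<close> term
      survives.\<close>
    using rec[of "n - 1" 0] that by simp
  ultimately show ?thesis by blast
qed

end
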